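(* Consider the aggregate-and-iterative-disaggregate (AID) algorithm for least absolute deviation regression with data $x\in\mathbb{R}^{n\times m}$, $y\in\mathbb{R}^n$, with optimal aggregated values $F^t$, original objective values $E^t$, and last iteration $T$. In any iteration $t$, $F^t$ is a lower bound on $E^*=\min_{\beta\in\mathbb{R}^m}\sum_{i\in I}|y_i-\sum_{j\in J}x_{ij}\beta_j|$. Further, the optimality gap $$\frac{E^{\mathrm{best}}-F^t}{E^{\mathrm{best}}},\qquad E^{\mathrm{best}}=\min_{s=1,\dots,t}E^s,$$ is non-increasing in $t$ (over those $t\in\{1,\dots,T\}$ for which $E^{\mathrm{best}}>0$).
   Context: $I=\{1,\dots,n\}$, $J=\{1,\dots,m\}$. The algorithm starts from an arbitrary partition $C^0$ of $I$ into nonempty clusters. In iteration $t$, given the partition $C^t=\{C_k^t\}_{k\in K^t}$, set $x_{kj}^t=\frac{1}{|C_k^t|}\sum_{i\in C_k^t}x_{ij}$ and $y_k^t=\frac{1}{|C_k^t|}\sum_{i\in C_k^t}y_i$; let $$F^t=\min_{\beta\in\mathbb{R}^m}\sum_{k\in K^t}|C_k^t|\,\Big|y_k^t-\sum_{j\in J}x_{kj}^t\beta_j\Big|,$$ let $\bar\beta^t$ be an optimal solution of this problem, and let $E^t=\sum_{i\in I}|y_i-\sum_{j\in J}x_{ij}\bar\beta_j^t|$. Optimality condition: for every $k\in K^t$ the residuals $y_i-\sum_jx_{ij}\bar\beta_j^t$, $i\in C_k^t$, all have the same sign (all $>0$, or all $\le0$). If it holds, the algorithm stops and $T:=t$. Otherwise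 $C^{t+1}$ is obtained from $C^t$ by keeping every cluster whose residuals have the same sign, and replacing every other cluster $C_k^t$ by the two clusters $\{i\in C_k^t: y_i-\sum_jx_{ij}\bar\beta_j^t>0\}$ and $\{i\in C_k^t: y_i-\sum_jx_{ij}\bar\beta_j^t\le0\}$. $E^{\mathrm{best}}$ depends on the current iteration $t$. *)

theory Defs
  imports "HOL-Analysis.Analysis"
begin

text \<open>Observations are indexed by \<open>'n\<close> (the set \<open>I\<close>), attributes by \<open>'m\<close> (the set \<open>J\<close>).
  A family of clusters is a set of sets of observations, so a cluster serves as its own index.\<close>

definition residual :: "real^'m^'n \<Rightarrow> real^'n \<Rightarrow> real^'m \<Rightarrow> 'n \<Rightarrow> real" where
  "residual x y \<beta> i = y $ i - (\<Sum>j\<in>UNIV. x $ i $ j * \<beta> $ j)"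

definition lad_obj :: "real^'m^'n \<Rightarrow> real^'n \<Rightarrow> real^'m \<Rightarrow> real" where
  "lad_obj x y \<beta> = (\<Sum>i\<in>UNIV. \<bar>residual x y \<beta> i\<bar>)"

text \<open>\<open>LEAST\<close> over the range is the attained minimum, not merely the infimum: its value is
  unspecified if no minimum exists.\<close>

definition lad_min :: "real^'m^'n \<Rightarrow> real^'n \<Rightarrow> real" where
  "lad_min x y = (LEAST v. v \<in> range (lad_obj x y))"

definition agg_x :: "real^'m^'n \<Rightarrow> 'n set \<Rightarrow> 'm \<Rightarrow> real" where
  "agg_x x c j = (\<Sum>i\<in>c. x $ i $ j) / real (card c)"

definition agg_y :: "real^'n \<Rightarrow> 'n set \<Rightarrow> real" where
  "agg_y y c = (\<Sum>i\<in>c. y $ i) / real (card c)"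

definition agg_obj :: "real^'m^'n \<Rightarrow> real^'n \<Rightarrow> 'n set set \<Rightarrow> real^'m \<Rightarrow> real" where
  "agg_obj x y C \<beta> =
     (\<Sum>c\<in>C. real (card c) * \<bar>agg_y y c - (\<Sum>j\<in>UNIV. agg_x x c j * \<beta> $ j)\<bar>)"

definition agg_min :: "real^'m^'n \<Rightarrow> real^'n \<Rightarrow> 'n set set \<Rightarrow> real" where
  "agg_min x y C = (LEAST v. v \<in> range (agg_obj x y C))"

definition same_sign :: "real^'m^'n \<Rightarrow> real^'n \<Rightarrow> real^'m \<Rightarrow> 'n set \<Rightarrow> bool" where
  "same_sign x y \<beta> c \<longleftrightarrow>
     (\<forall>i\<in>c. residual x y \<beta> i > 0) \<or> (\<forall>i\<in>c. residual x y \<beta> i \<le> 0)"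

definition disaggregate ::
    "real^'m^'n \<Rightarrow> real^'n \<Rightarrow> real^'m \<Rightarrow> 'n set set \<Rightarrow> 'n set set" where
  "disaggregate x y \<beta> C =
     {c \<in> C. same_sign x y \<beta> c} \<union>
     (\<Union>c\<in>{c \<in> C. \<not> same_sign x y \<beta> c}.
        {{i \<in> c. residual x y \<beta> i > 0}, {i \<in> c. residual x y \<beta> i \<le> 0}})"

text \<open>\<open>aid_run x y C \<beta> T\<close>: the algorithm visits the partitions \<open>C 0, \<dots>, C T\<close>, chooses the optimal
  aggregated solutions \<open>\<beta> 0, \<dots>, \<beta> T\<close> (any optimal solution may be chosen), and stops in
  iteration \<open>T\<close>. The values of \<open>C\<close> and \<open>\<beta>\<close> beyond \<open>T\<close> are irrelevant.\<close>

definition aid_run ::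
    "real^'m^'n \<Rightarrow> real^'n \<Rightarrow> (nat \<Rightarrow> 'n set set) \<Rightarrow> (nat \<Rightarrow> real^'m) \<Rightarrow> nat \<Rightarrow> bool" where
  "aid_run x y C \<beta> T \<longleftrightarrow>
     partition_on UNIV (C 0) \<and>
     (\<forall>t\<le>T. is_arg_min (agg_obj x y (C t)) (\<lambda>_. True) (\<beta> t)) \<and>
     (\<forall>t<T. \<not> (\<forall>c\<in>C t. same_sign x y (\<beta> t) c) \<and>
            C (Suc t) = disaggregate x y (\<beta> t) (C t)) \<and>
     (\<forall>c\<in>C T. same_sign x y (\<beta> T) c)"

definition best_obj :: "real^'m^'n \<Rightarrow> real^'n \<Rightarrow> (nat \<Rightarrow> real^'m) \<Rightarrow> nat \<Rightarrow> real" where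
  "best_obj x y \<beta> t = Min ((\<lambda>s. lad_obj x y (\<beta> s)) ` {1..t})"

definition opt_gap ::
    "real^'m^'n \<Rightarrow> real^'n \<Rightarrow> (nat \<Rightarrow> 'n set set) \<Rightarrow> (nat \<Rightarrow> real^'m) \<Rightarrow> nat \<Rightarrow> real" where
  "opt_gap x y C \<beta> t = (best_obj x y \<beta> t - agg_min x y (C t)) / best_obj x y \<beta> t"

end

theory Submission
  imports Defs
begin

text \<open>A cluster contributes the absolute value of its residual sum to the aggregated objective, so
  refining a partition can only increase that objective, and the original objective is the
  aggregated one for the finest partition. In the last iteration the residuals of each cluster have
  the same sign, hence both objectives agree at \<open>\<beta> T\<close>, which therefore minimises the original one:
  this is why the minimum is attained.\<close>

text \<open>The weight \<open>card c\<close> cancels the denominators of the averages. In this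
  division-free form the objectives of different partitions can be compared.\<close>

lemma agg_obj_eq: "agg_obj x y C \<beta> = (\<Sum>c\<in>C. \<bar>\<Sum>i\<in>c. residual x y \<beta> i\<bar>)"
  for x :: "real^'m^'n"
  unfolding agg_obj_def
proof (rule sum.cong[OF refl])
  fix c :: "'n set"
  show "real (card c) * \<bar>agg_y y c - (\<Sum>j\<in>UNIV. agg_x x c j * \<beta> $ j)\<bar> = \<bar>\<Sum>i\<in>c. residual x y \<beta> i\<bar>"
  proof (cases "c = {}")
    case False
    have "(\<Sum>j\<in>UNIV. agg_x x c j * \<beta> $ j) = (\<Sum>j\<in>UNIV. \<Sum>i\<in>c. x $ i $ j * \<beta> $ j) / real (card c)"
      by (simp add: agg_x_def sum_distrib_right sum_divide_distrib)
    also have "(\<Sum>j\<in>UNIV. \<Sum>i\<in>c. x $ i $ j * \<beta> $ j) = (\<Sum>i\<in>c. \<Sum>j\<in>UNIV. x $ i $ j * \<beta> $ j)"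
      by (rule sum.swap)
    finally have "agg_y y c - (\<Sum>j\<in>UNIV. agg_x x c j * \<beta> $ j)
        = (\<Sum>i\<in>c. residual x y \<beta> i) / real (card c)"
      by (simp add: agg_y_def residual_def sum_subtractf diff_divide_distrib)
    then show ?thesis using False by (simp add: card_gt_0_iff)
  qed simp
qed

lemma agg_obj_nonneg: "0 \<le> agg_obj x y C \<beta>"
  by (simp add: agg_obj_eq sum_nonneg)

text \<open>Triangle inequality inside each coarse cluster, followed by regrouping the double sum:
  every fine cluster lies in exactly one coarse cluster.\<close>

lemma agg_obj_refines_le:
  fixes x :: "real^'m^'n"
  assumes "refines UNIV D C"
  shows "agg_obj x y C \<beta> \<le> agg_obj x y D \<beta>"
proof -
  let ?r = "residual x y \<beta>"
  have D: "partition_on UNIV D" and C: "partition_on UNIV C"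
    using assms by (auto simp: refines_def)
  have part: "partition_on c {d \<in> D. d \<subseteq> c}" if "c \<in> C" for c
    using refines_obtains_subset[OF assms that] .
  have "\<bar>\<Sum>i\<in>c. ?r i\<bar> \<le> (\<Sum>d\<in>{d \<in> D. d \<subseteq> c}. \<bar>\<Sum>i\<in>d. ?r i\<bar>)" if "c \<in> C" for c
  proof -
    have "(\<Sum>i\<in>c. ?r i) = (\<Sum>d\<in>{d \<in> D. d \<subseteq> c}. \<Sum>i\<in>d. ?r i)"
      using sum.partition[OF _ part[OF that], of ?r] by simp
    then show ?thesis by (metis sum_abs)
  qed
  then have "agg_obj x y C \<beta> \<le> (\<Sum>c\<in>C. \<Sum>d\<in>{d \<in> D. d \<subseteq> c}. \<bar>\<Sum>i\<in>d. ?r i\<bar>)"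
    unfolding agg_obj_eq by (rule sum_mono)
  also have "\<dots> = (\<Sum>d\<in>(\<Union>c\<in>C. {d \<in> D. d \<subseteq> c}). \<bar>\<Sum>i\<in>d. ?r i\<bar>)"
  proof (rule sum.UNION_disjoint[symmetric])
    show "\<forall>c\<in>C. \<forall>c'\<in>C. c \<noteq> c' \<longrightarrow> {d \<in> D. d \<subseteq> c} \<inter> {d \<in> D. d \<subseteq> c'} = {}"
    proof (intro ballI impI)
      fix c c' assume "c \<in> C" "c' \<in> C" "c \<noteq> c'"
      then have "c \<inter> c' = {}" using partition_onD2[OF C] by (simp add: disjointD)
      \<comment> \<open>Only the empty set fits into two disjoint clusters, and \<open>D\<close>
        does not contain it.\<close>
      then have "d = {}" if "d \<subseteq> c" "d \<subseteq> c'" for d using that by blast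
      then show "{d \<in> D. d \<subseteq> c} \<inter> {d \<in> D. d \<subseteq> c'} = {}"
        using partition_onD3[OF D] by blast
    qed
  qed auto
  also have "(\<Union>c\<in>C. {d \<in> D. d \<subseteq> c}) = D"
    using assms by (auto simp: refines_def)
  finally show ?thesis by (simp add: agg_obj_eq)
qed

text \<open>The partition into singletons refines every partition, so this is an instance of
  monotonicity under refinement.\<close>

lemma agg_obj_le_lad_obj:
  fixes x :: "real^'m^'n"
  assumes "partition_on UNIV C"
  shows "agg_obj x y C \<beta> \<le> lad_obj x y \<beta>"
proof -
  have "refines UNIV (range (\<lambda>i. {i})) C"
    using assms by (auto simp: refines_def partition_on_def disjoint_def)
  moreover have "agg_obj x y (range (\<lambda>i. {i})) \<beta> = lad_obj x y \<beta>"
    by (simp add: agg_obj_eq lad_obj_def sum.reindex)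
  ultimately show ?thesis using agg_obj_refines_le by metis
qed

text \<open>Residuals of one sign do not cancel, so the triangle inequality is tight in every
  cluster.\<close>

lemma agg_obj_eq_lad_obj:
  fixes x :: "real^'m^'n"
  assumes C: "partition_on UNIV C" and sign: "\<forall>c\<in>C. same_sign x y \<beta> c"
  shows "agg_obj x y C \<beta> = lad_obj x y \<beta>"
proof -
  have "\<bar>\<Sum>i\<in>c. residual x y \<beta> i\<bar> = (\<Sum>i\<in>c. \<bar>residual x y \<beta> i\<bar>)" if "c \<in> C" for c
  proof -
    from sign that consider "\<forall>i\<in>c. residual x y \<beta> i > 0" | "\<forall>i\<in>c. residual x y \<beta> i \<le> 0"
      unfolding same_sign_def by blast
    then show ?thesis
    proof cases
      case 1
      then show ?thesis by (simp add: sum_nonneg less_imp_le)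
    next
      case 2
      then show ?thesis by (simp add: sum_nonpos abs_of_nonpos sum_negf)
    qed
  qed
  then show ?thesis
    using sum.partition[OF _ C, of "\<lambda>i. \<bar>residual x y \<beta> i\<bar>"] by (simp add: agg_obj_eq lad_obj_def)
qed

text \<open>Since \<open>refines\<close> includes that both families are partitions, this yields the
  partition invariant of a run as well as the monotonicity of the aggregated minima.\<close>

lemma disaggregate_refines:
  assumes "partition_on UNIV C"
  shows "refines UNIV (disaggregate x y \<beta> C) C"
proof -
  let ?D = "disaggregate x y \<beta> C"
  \<comment> \<open>The clusters that replace \<open>c\<close>. Writing the new family as one union
    over \<open>C\<close> lets every new cluster be traced back to a parent.\<close>
  let ?parts = "\<lambda>c. if same_sign x y \<beta> c then {c}
    else {{i \<in> c. residual x y \<beta> i > 0}, {i \<in> c. residual x y \<beta> i \<le> 0}}"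
  have D: "?D = (\<Union>c\<in>C. ?parts c)"
    unfolding disaggregate_def by (auto split: if_splits)
  have parts_sub: "d \<subseteq> c" if "d \<in> ?parts c" for c d
    using that by (auto split: if_splits)
  have sub: "\<exists>c\<in>C. d \<subseteq> c" if "d \<in> ?D" for d
    using that parts_sub unfolding D by blast
  have "\<Union>?D = UNIV"
  proof (rule UNIV_eq_I[symmetric])
    fix i
    obtain c where c: "c \<in> C" "i \<in> c" using partition_onD1[OF assms] by blast
    then have "i \<in> \<Union>(?parts c)" by (auto simp: not_less)
    then show "i \<in> \<Union>?D" using c(1) unfolding D by blast
  qed
  moreover have "disjoint ?D"
  proof (rule disjointI)
    fix d e assume de: "d \<in> ?D" "e \<in> ?D" "d \<noteq> e"
    obtain c where c: "c \<in> C" and d: "d \<in> ?parts c"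
      using de(1) unfolding D by blast
    obtain c' where c': "c' \<in> C" and e: "e \<in> ?parts c'"
      using de(2) unfolding D by blast
    show "d \<inter> e = {}"
    \<comment> \<open>Pieces of one parent are separated by the sign of the residual, pieces of
      different parents by the disjointness of the parents.\<close>
    proof (cases "c = c'")
      case True
      then have "e \<in> ?parts c" using e by (simp only:)
      then show ?thesis using d de(3) by (cases "same_sign x y \<beta> c") auto
    next
      case False
      then have "c \<inter> c' = {}" using partition_onD2[OF assms] c c' by (simp add: disjointD)
      then show ?thesis using parts_sub[OF d] parts_sub[OF e] by blast
    qed
  qed
  moreover have "{} \<notin> ?D"
  proof
    assume "{} \<in> ?D"
    then obtain c where c: "c \<in> C" "{} \<in> ?parts c" unfolding D by blast
    \<comment> \<open>An empty piece must therefore be half of a split cluster, but then the other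
      half is all of \<open>c\<close>, whose residuals would have the same sign.\<close>
    have "c \<noteq> {}" using partition_onD3[OF assms] c(1) by blast
    with c(2) have "\<not> same_sign x y \<beta> c" "{i \<in> c. residual x y \<beta> i > 0} = {} \<or>
        {i \<in> c. residual x y \<beta> i \<le> 0} = {}"
      by (auto split: if_splits)
    then show False unfolding same_sign_def by (auto simp: not_less not_le)
  qed
  ultimately show ?thesis
    using assms sub by (auto simp: refines_def partition_on_def)
qed

text \<open>Exhibiting a minimiser pins down the value of \<open>LEAST\<close>; this serves both
  \<open>agg_min\<close> and \<open>lad_min\<close>.\<close>

lemma is_arg_min_Least_range:
  fixes f :: "'a \<Rightarrow> 'b::linorder"
  assumes "is_arg_min f (\<lambda>_. True) a"
  shows "(LEAST v. v \<in> range f) = f a"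
  using assms by (intro Least_equality) (auto simp: is_arg_min_linorder)

text \<open>\<open>aid_run\<close> demands this of \<open>C 0\<close> only; each disaggregation step
  preserves it.\<close>

lemma aid_run_partition:
  assumes run: "aid_run x y C \<beta> T" and "t \<le> T"
  shows "partition_on UNIV (C t)"
  using \<open>t \<le> T\<close>
proof (induction t)
  case 0
  then show ?case using run by (simp add: aid_run_def)
next
  case (Suc t)
  then have "C (Suc t) = disaggregate x y (\<beta> t) (C t)"
    using run by (auto simp: aid_run_def)
  then show ?case using Suc disaggregate_refines[of "C t" x y "\<beta> t"] by (simp add: refines_def)
qed

lemma aid_run_agg_min:
  assumes "aid_run x y C \<beta> T" "t \<le> T"
  shows "agg_min x y (C t) = agg_obj x y (C t) (\<beta> t)"
    and "agg_min x y (C t) \<le> agg_obj x y (C t) b"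
proof -
  have min: "is_arg_min (agg_obj x y (C t)) (\<lambda>_. True) (\<beta> t)"
    using assms by (auto simp: aid_run_def)
  show *: "agg_min x y (C t) = agg_obj x y (C t) (\<beta> t)"
    unfolding agg_min_def by (rule is_arg_min_Least_range[OF min])
  show "agg_min x y (C t) \<le> agg_obj x y (C t) b"
    using min by (simp add: * is_arg_min_linorder)
qed

lemma aid_run_agg_min_le_lad_obj:
  assumes "aid_run x y C \<beta> T" "t \<le> T"
  shows "agg_min x y (C t) \<le> lad_obj x y b"
  using aid_run_agg_min(2)[OF assms] agg_obj_le_lad_obj[OF aid_run_partition[OF assms]]
  by (rule order_trans)

text \<open>\<open>agg_min x y (C T)\<close> bounds \<open>lad_obj x y\<close> from below
  everywhere, and \<open>\<beta> T\<close> attains this bound.\<close>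

lemma aid_run_lad_min:
  assumes run: "aid_run x y C \<beta> T"
  shows "lad_min x y = lad_obj x y (\<beta> T)"
proof -
  have "lad_obj x y (\<beta> T) = agg_min x y (C T)"
    using aid_run_agg_min(1)[OF run, of T] agg_obj_eq_lad_obj[OF aid_run_partition[OF run], of T x y] run
    by (simp add: aid_run_def)
  then have "is_arg_min (lad_obj x y) (\<lambda>_. True) (\<beta> T)"
    using aid_run_agg_min_le_lad_obj[OF run] by (simp add: is_arg_min_linorder)
  then show ?thesis
    unfolding lad_min_def by (rule is_arg_min_Least_range)
qed

lemma aid_run_agg_min_mono:
  assumes run: "aid_run x y C \<beta> T" and "s \<le> t" "t \<le> T"
  shows "agg_min x y (C s) \<le> agg_min x y (C t)"
  using \<open>s \<le> t\<close> \<open>t \<le> T\<close>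
proof (induction t rule: dec_induct)
  case (step t)
  then have "C (Suc t) = disaggregate x y (\<beta> t) (C t)"
    using run by (auto simp: aid_run_def)
  then have ref: "refines UNIV (C (Suc t)) (C t)"
    using disaggregate_refines aid_run_partition[OF run, of t] step.prems by simp
  have "agg_min x y (C s) \<le> agg_min x y (C t)" using step by simp
  \<comment> \<open>The minimiser for the finer partition is used as a competitor in the coarser
    problem.\<close>
  also have "\<dots> \<le> agg_obj x y (C t) (\<beta> (Suc t))"
    using aid_run_agg_min(2)[OF run] step.prems by simp
  also have "\<dots> \<le> agg_obj x y (C (Suc t)) (\<beta> (Suc t))"
    by (rule agg_obj_refines_le[OF ref])
  also have "\<dots> = agg_min x y (C (Suc t))"
    using aid_run_agg_min(1)[OF run step.prems] by simp
  finally show ?case .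
qed simp

lemma best_obj_antimono:
  assumes "1 \<le> s" "s \<le> t"
  shows "best_obj x y \<beta> t \<le> best_obj x y \<beta> s"
  \<comment> \<open>\<open>1 \<le> s\<close> keeps \<open>{1..s}\<close> nonempty, so that both
    minima are meaningful.\<close>
  unfolding best_obj_def using assms by (intro Min_antimono image_mono) auto

theorem mainTheorem3:
  fixes x :: "real^'m^'n" and y :: "real^'n"
    and C :: "nat \<Rightarrow> 'n set set" and \<beta> :: "nat \<Rightarrow> real^'m" and T :: nat
  assumes "aid_run x y C \<beta> T"
  shows "(\<forall>t\<le>T. agg_min x y (C t) \<le> lad_min x y) \<and>
         antimono_on {t \<in> {1..T}. best_obj x y \<beta> t > 0} (opt_gap x y C \<beta>)"
proof (intro conjI allI impI monotone_onI)
  fix t assume "t \<le> T"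
  then show "agg_min x y (C t) \<le> lad_min x y"
    using aid_run_agg_min_le_lad_obj[OF assms] aid_run_lad_min[OF assms] by simp
next
  fix s t
  assume s: "s \<in> {t \<in> {1..T}. best_obj x y \<beta> t > 0}"
    and t: "t \<in> {t \<in> {1..T}. best_obj x y \<beta> t > 0}" and "s \<le> t"
  let ?E = "best_obj x y \<beta>" and ?F = "\<lambda>t. agg_min x y (C t)"
  have "0 \<le> ?F s"
    using aid_run_agg_min(1)[OF assms, of s] agg_obj_nonneg s by simp
  moreover have "?F s \<le> ?F t"
    using aid_run_agg_min_mono[OF assms \<open>s \<le> t\<close>] t by simp
  moreover have "?E t \<le> ?E s"
    using \<open>s \<le> t\<close> s by (intro best_obj_antimono) auto
  \<comment> \<open>Where \<open>?E\<close> is positive, the gap equals \<open>1 - ?F / ?E\<close>,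
    so it suffices that this ratio grows. Nonnegativity of \<open>?F\<close> matters because the
    denominator may shrink.\<close>
  ultimately have "?F s / ?E s \<le> ?F t / ?E t"
    using t by (intro frac_le) auto
  then show "opt_gap x y C \<beta> t \<le> opt_gap x y C \<beta> s"
    using s t by (simp add: opt_gap_def diff_divide_distrib)
qed

end
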